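(* Let $\mathcal{M}=(\Phi,\mathcal{W},C,P)$ be a many-to-one matching market in which every firm has a path-independent choice function. For any Aizerman–Malishevski decomposition of the firms' choice functions, with associated one-to-one market $M$, there is an isomorphism (i.e. a bijection) between the set $S^*(M)$ of stable* matchings of $M$ and the set $S(\mathcal{M})$ of stable matchings of $\mathcal{M}$.
   Context: **Many-to-one market.** $\Phi=\{\varphi_1,\dots,\varphi_n\}$ is a finite set of firms, $I=\{1,\dots,n\}$, and $\mathcal{W}$ is a finite set of workers. Each firm $\varphi$ has a choice function $C_\varphi:2^{\mathcal{W}}\to 2^{\mathcal{W}}$ with $C_\varphi(W)\subseteq W$ for all $W\subseteq\mathcal{W}$. It is path-independent if $C_\varphi(W\cup W')=C_\varphi(C_\varphi(W)\cup W')$ for all $W,W'\subseteq\mathcal{W}$. Each worker $w$ has a strict linear order $P_w$ on $\Phi\cup\{\emptyset\}$, where $\emptyset$ stands for being unmatched. A (many-to-one) matching is a map $\mu$ on $\Phi\cup\mathcal{W}$ with $\mu(w)\in\Phi\cup\{\emptyset\}$ for $w\in\mathcal{W}$, $\mu(\varphi)\subseteq\mathcal{W}$ for $\varphi\in\Phi$, and $\mu(w)=\varphi\iff w\in\mu(\varphi)$. It is blocked by a worker $w$ if $\emptyset P_w\mu(w)$; by a firm $\varphi$ if $\mu(\varphi)\ne C_\varphi(\mu(\varphi))$; by a pair $(w,\varphi)$ if $w\notin\mu(\varphi)$, $w\in C_\varphi(\mu(\varphi)\cup\{w\})$ and $\varphi P_w\mu(w)$. It is stable if it is not blocked by any worker,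 firm, or worker-firm pair. $S(\mathcal{M})$ is the set of stable matchings. **Aizerman–Malishevski decomposition.** For firm $\varphi_i$ this is a finite sequence $(P_{ij})_{j\in J_i}$, $J_i=\{1,\dots,|J_i|\}$, of strict linear orders on $\mathcal{W}\cup\{\emptyset\}$ such that $C_{\varphi_i}(S)=\bigcup_{j\in J_i}\max_S P_{ij}$ for all $S\subseteq\mathcal{W}$. Here $\max_S P_{ij}$ is the singleton of the $P_{ij}$-best worker of $S$ if that worker is preferred to $\emptyset$, and is empty if no worker in $S$ is preferred to $\emptyset$. Such a sequence exists if and only if $C_{\varphi_i}$ is path-independent. **Associated one-to-one market $M$.** The firm-copies are $\mathcal{F}=\{f_{ij}: i\in I, j\in J_i\}$; copy $f_{ij}$ has preference $P_{ij}$. Each worker $w$ has a strict linear order $\overline{P}_w$ on $\mathcal{F}\cup\{\emptyset\}$ such that: (1) $\varphi_iP_w\varphi_{i'}$ implies $f_{ij}\overline{P}_wf_{i'j'}$ for all $j\in J_i$, $j'\in J_{i'}$, and likewise each $f_{ij}$ is on the same side of $\emptyset$ in $\overline{P}_w$ as $\varphi_i$ is in $P_w$; (2) $f_{ij}\overline{P}_wf_{ij'}$ if and only if $j<j'$. A matching of $M$ is a map $\lambda:\mathcal{F}\cup\mathcal{W}\to\mathcal{F}\cup\mathcal{W}\cup\{\emptyset\}$ with $\lambda(f)\in\mathcal{W}\cup\{\emptyset\}$, $\lambda(w)\in\mathcal{F}\cup\{\emptyset\}$, and $\lambda(f)=w\iff\lambda(w)=f$. **Stability*.** $\lambda$ is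 blocked* by a worker $w$ if $\emptyset\,\overline{P}_w\,\lambda(w)$. It is blocked* by a firm-copy $f_{ij}$ if either $\emptyset P_{ij}\lambda(f_{ij})$, or $\lambda(f_{ij})\neq\emptyset$ and there is $j'\in J_i$ with $\lambda(f_{ij'})P_{ij}\lambda(f_{ij})$. It is blocked* by a pair $(f_{ij},w)$ if $f_{ij}\overline{P}_w\lambda(w)$ and $wP_{ij}\lambda(f_{ij'})$ for each $j'\in J_i$. $\lambda$ is stable* if it is not blocked* by any worker, any firm-copy, or any pair (firm-copy, worker). $S^*(M)$ is the set of stable* matchings of $M$.
   Formalization: In the definition of a blocking* pair (f_ij, w), the condition that w P_ij λ(f_ij') is required only for those j' in J_i with λ(f_ij') ≠ w; with the condition required for every j', the claim is false (one firm with two copies, one worker). *)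

theory Defs
  imports Main "HOL-Library.FuncSet"
begin

text \<open>
  The empty set in its role as ``unmatched'' is \<open>None\<close>, an agent \<open>x\<close> is \<open>Some x\<close>. A preference is
  a set of pairs, and \<open>(x, y) \<in> r\<close> says that \<open>x\<close> is strictly preferred to \<open>y\<close>.
\<close>

definition with_none :: "'a set \<Rightarrow> 'a option set" where
  "with_none A = insert None (Some ` A)"

definition strict_pref_on :: "'a set \<Rightarrow> 'a option rel \<Rightarrow> bool" where
  "strict_pref_on A r \<longleftrightarrow>
     r \<subseteq> with_none A \<times> with_none A \<and> strict_linear_order_on (with_none A) r"

definition path_independent :: "'w set \<Rightarrow> ('w set \<Rightarrow> 'w set) \<Rightarrow> bool" where
  "path_independent W c \<longleftrightarrow> (\<forall>S\<subseteq>W. \<forall>T\<subseteq>W. c (S \<union> T) = c (c S \<union> T))"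

definition many_to_one_market ::
  "'f set \<Rightarrow> 'w set \<Rightarrow> ('f \<Rightarrow> 'w set \<Rightarrow> 'w set) \<Rightarrow> ('w \<Rightarrow> 'f option rel) \<Rightarrow> bool" where
  "many_to_one_market \<Phi> W C P \<longleftrightarrow>
     finite \<Phi> \<and> finite W \<and>
     (\<forall>\<phi>\<in>\<Phi>. \<forall>S\<subseteq>W. C \<phi> S \<subseteq> S) \<and>
     (\<forall>w\<in>W. strict_pref_on \<Phi> (P w))"

text \<open>
  A matching is the pair of its restrictions to the workers and to the firms. Both are extensional
  (equal to \<open>undefined\<close> off the market), so that distinct elements are distinct matchings.
\<close>

type_synonym ('f, 'w) matching = "('w \<Rightarrow> 'f option) \<times> ('f \<Rightarrow> 'w set)"

definition is_matching :: "'f set \<Rightarrow> 'w set \<Rightarrow> ('f, 'w) matching \<Rightarrow> bool" where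
  "is_matching \<Phi> W \<mu> \<longleftrightarrow>
     fst \<mu> \<in> W \<rightarrow>\<^sub>E with_none \<Phi> \<and> snd \<mu> \<in> \<Phi> \<rightarrow>\<^sub>E Pow W \<and>
     (\<forall>w\<in>W. \<forall>\<phi>\<in>\<Phi>. fst \<mu> w = Some \<phi> \<longleftrightarrow> w \<in> snd \<mu> \<phi>)"

definition worker_blocks :: "('w \<Rightarrow> 'f option rel) \<Rightarrow> ('f, 'w) matching \<Rightarrow> 'w \<Rightarrow> bool" where
  "worker_blocks P \<mu> w \<longleftrightarrow> (None, fst \<mu> w) \<in> P w"

definition firm_blocks ::
  "('f \<Rightarrow> 'w set \<Rightarrow> 'w set) \<Rightarrow> ('f, 'w) matching \<Rightarrow> 'f \<Rightarrow> bool" where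
  "firm_blocks C \<mu> \<phi> \<longleftrightarrow> snd \<mu> \<phi> \<noteq> C \<phi> (snd \<mu> \<phi>)"

definition pair_blocks ::
  "('f \<Rightarrow> 'w set \<Rightarrow> 'w set) \<Rightarrow> ('w \<Rightarrow> 'f option rel) \<Rightarrow> ('f, 'w) matching \<Rightarrow> 'w \<Rightarrow> 'f \<Rightarrow> bool" where
  "pair_blocks C P \<mu> w \<phi> \<longleftrightarrow>
     w \<notin> snd \<mu> \<phi> \<and> w \<in> C \<phi> (snd \<mu> \<phi> \<union> {w}) \<and> (Some \<phi>, fst \<mu> w) \<in> P w"

definition stable_matchings ::
  "'f set \<Rightarrow> 'w set \<Rightarrow> ('f \<Rightarrow> 'w set \<Rightarrow> 'w set) \<Rightarrow> ('w \<Rightarrow> 'f option rel) \<Rightarrow> ('f, 'w) matching set" where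
  "stable_matchings \<Phi> W C P =
     {\<mu>. is_matching \<Phi> W \<mu> \<and>
          (\<forall>w\<in>W. \<not> worker_blocks P \<mu> w) \<and>
          (\<forall>\<phi>\<in>\<Phi>. \<not> firm_blocks C \<mu> \<phi>) \<and>
          (\<forall>w\<in>W. \<forall>\<phi>\<in>\<Phi>. \<not> pair_blocks C P \<mu> w \<phi>)}"

definition max_pref :: "'w set \<Rightarrow> 'w option rel \<Rightarrow> 'w set" where
  "max_pref S r =
     {w \<in> S. (Some w, None) \<in> r \<and> (\<forall>v\<in>S. v \<noteq> w \<longrightarrow> (Some w, Some v) \<in> r)}"

text \<open>
  The index set of firm \<open>\<phi>\<close> is \<open>{1..k \<phi>}\<close>, and \<open>Q \<phi> j\<close> is its \<open>j\<close>-th order. The length \<open>k \<phi>\<close> may be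
  \<open>0\<close>, in which case \<open>\<phi>\<close> always chooses the empty set.
\<close>

definition AM_decomposition ::
  "'w set \<Rightarrow> ('w set \<Rightarrow> 'w set) \<Rightarrow> nat \<Rightarrow> (nat \<Rightarrow> 'w option rel) \<Rightarrow> bool" where
  "AM_decomposition W c m q \<longleftrightarrow>
     (\<forall>j\<in>{1..m}. strict_pref_on W (q j)) \<and>
     (\<forall>S\<subseteq>W. c S = (\<Union>j\<in>{1..m}. max_pref S (q j)))"

type_synonym 'f firm_copy = "'f \<times> nat"

definition copies :: "'f set \<Rightarrow> ('f \<Rightarrow> nat) \<Rightarrow> 'f firm_copy set" where
  "copies \<Phi> k = (SIGMA \<phi>:\<Phi>. {1..k \<phi>})"

definition associated_pref ::
  "'f set \<Rightarrow> ('f \<Rightarrow> nat) \<Rightarrow> 'f option rel \<Rightarrow> 'f firm_copy option rel \<Rightarrow> bool" where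
  "associated_pref \<Phi> k p pbar \<longleftrightarrow>
     strict_pref_on (copies \<Phi> k) pbar \<and>
     (\<forall>\<phi>\<in>\<Phi>. \<forall>\<phi>'\<in>\<Phi>. (Some \<phi>, Some \<phi>') \<in> p \<longrightarrow>
        (\<forall>j\<in>{1..k \<phi>}. \<forall>j'\<in>{1..k \<phi>'}. (Some (\<phi>, j), Some (\<phi>', j')) \<in> pbar)) \<and>
     (\<forall>\<phi>\<in>\<Phi>. \<forall>j\<in>{1..k \<phi>}.
        ((Some (\<phi>, j), None) \<in> pbar \<longleftrightarrow> (Some \<phi>, None) \<in> p) \<and>
        ((None, Some (\<phi>, j)) \<in> pbar \<longleftrightarrow> (None, Some \<phi>) \<in> p)) \<and>
     (\<forall>\<phi>\<in>\<Phi>. \<forall>j\<in>{1..k \<phi>}. \<forall>j'\<in>{1..k \<phi>}.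
        (Some (\<phi>, j), Some (\<phi>, j')) \<in> pbar \<longleftrightarrow> j < j')"

type_synonym ('f, 'w) one_matching =
  "('w \<Rightarrow> 'f firm_copy option) \<times> ('f firm_copy \<Rightarrow> 'w option)"

definition is_one_matching ::
  "'f set \<Rightarrow> 'w set \<Rightarrow> ('f \<Rightarrow> nat) \<Rightarrow> ('f, 'w) one_matching \<Rightarrow> bool" where
  "is_one_matching \<Phi> W k \<nu> \<longleftrightarrow>
     fst \<nu> \<in> W \<rightarrow>\<^sub>E with_none (copies \<Phi> k) \<and> snd \<nu> \<in> copies \<Phi> k \<rightarrow>\<^sub>E with_none W \<and>
     (\<forall>f\<in>copies \<Phi> k. \<forall>w\<in>W. snd \<nu> f = Some w \<longleftrightarrow> fst \<nu> w = Some f)"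

definition worker_blocks_star ::
  "('w \<Rightarrow> 'f firm_copy option rel) \<Rightarrow> ('f, 'w) one_matching \<Rightarrow> 'w \<Rightarrow> bool" where
  "worker_blocks_star Pbar \<nu> w \<longleftrightarrow> (None, fst \<nu> w) \<in> Pbar w"

definition copy_blocks_star ::
  "('f \<Rightarrow> nat) \<Rightarrow> ('f \<Rightarrow> nat \<Rightarrow> 'w option rel) \<Rightarrow> ('f, 'w) one_matching \<Rightarrow> 'f \<Rightarrow> nat \<Rightarrow> bool" where
  "copy_blocks_star k Q \<nu> \<phi> j \<longleftrightarrow>
     (None, snd \<nu> (\<phi>, j)) \<in> Q \<phi> j \<or>
     snd \<nu> (\<phi>, j) \<noteq> None \<and>
       (\<exists>j'\<in>{1..k \<phi>}. (snd \<nu> (\<phi>, j'), snd \<nu> (\<phi>, j)) \<in> Q \<phi> j)"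

text \<open>
  In a blocking pair, \<open>w\<close> has to be better for \<open>(\<phi>, j)\<close> than the assignment of every copy of \<open>\<phi>\<close>.
  The copy that employs \<open>w\<close> itself, if there is one, is exempt. This exemption is a correction: the
  source states the condition with a strict comparison for all copies. Read literally, that
  prevents a worker employed at some copy of \<open>\<phi>\<close> from ever blocking with a better copy of \<open>\<phi>\<close>,
  and the correspondence with stable matchings fails. For one firm with two copies and one worker,
  everybody acceptable, both ways to employ the worker would be stable*, while the many-to-one
  market has a single stable matching.
\<close>

definition pair_blocks_star ::
  "('f \<Rightarrow> nat) \<Rightarrow> ('f \<Rightarrow> nat \<Rightarrow> 'w option rel) \<Rightarrow> ('w \<Rightarrow> 'f firm_copy option rel) \<Rightarrow>
   ('f, 'w) one_matching \<Rightarrow> 'f \<Rightarrow> nat \<Rightarrow> 'w \<Rightarrow> bool" where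
  "pair_blocks_star k Q Pbar \<nu> \<phi> j w \<longleftrightarrow>
     (Some (\<phi>, j), fst \<nu> w) \<in> Pbar w \<and>
     (\<forall>j'\<in>{1..k \<phi>}. snd \<nu> (\<phi>, j') \<noteq> Some w \<longrightarrow> (Some w, snd \<nu> (\<phi>, j')) \<in> Q \<phi> j)"

definition stable_star_matchings ::
  "'f set \<Rightarrow> 'w set \<Rightarrow> ('f \<Rightarrow> nat) \<Rightarrow> ('f \<Rightarrow> nat \<Rightarrow> 'w option rel) \<Rightarrow>
   ('w \<Rightarrow> 'f firm_copy option rel) \<Rightarrow> ('f, 'w) one_matching set" where
  "stable_star_matchings \<Phi> W k Q Pbar =
     {\<nu>. is_one_matching \<Phi> W k \<nu> \<and>
          (\<forall>w\<in>W. \<not> worker_blocks_star Pbar \<nu> w) \<and>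
          (\<forall>(\<phi>, j)\<in>copies \<Phi> k. \<not> copy_blocks_star k Q \<nu> \<phi> j) \<and>
          (\<forall>(\<phi>, j)\<in>copies \<Phi> k. \<forall>w\<in>W. \<not> pair_blocks_star k Q Pbar \<nu> \<phi> j w)}"

end

theory Submission
  imports Defs
begin

text \<open>
  Merging the copies of each firm sends a one-to-one matching to a many-to-one matching. A matching
  of the associated market is stable* if and only if its image is stable and every worker employed
  by a firm \<open>\<phi>\<close> with staff \<open>S\<close> sits at the first copy of \<open>\<phi>\<close> for which it is the best worker in \<open>S\<close>.
  Such a copy exists because the decomposition writes \<open>S = C \<phi> S\<close> as the union of the copies'
  best workers, so the copies can be recovered from the many-to-one matching.
\<close>

section \<open>Strict preferences and matchings given by their workers' side\<close>

lemma strict_pref_onD: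
  assumes "strict_pref_on A r"
  shows "(x, x) \<notin> r"
    and "(x, y) \<in> r \<Longrightarrow> (y, z) \<in> r \<Longrightarrow> (x, z) \<in> r"
    and "(x, y) \<in> r \<Longrightarrow> (y, x) \<notin> r"
    and "x \<in> with_none A \<Longrightarrow> y \<in> with_none A \<Longrightarrow> x \<noteq> y \<Longrightarrow> (x, y) \<in> r \<or> (y, x) \<in> r"
proof -
  have "trans r" "irrefl r" "total_on (with_none A) r"
    using assms unfolding strict_pref_on_def strict_linear_order_on_def by auto
  then show irr: "(x, x) \<notin> r"
    and tr: "(x, y) \<in> r \<Longrightarrow> (y, z) \<in> r \<Longrightarrow> (x, z) \<in> r"
    and "x \<in> with_none A \<Longrightarrow> y \<in> with_none A \<Longrightarrow> x \<noteq> y \<Longrightarrow> (x, y) \<in> r \<or> (y, x) \<in> r"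
    by (auto simp: irrefl_def total_on_def dest: transD)
  show "(x, y) \<in> r \<Longrightarrow> (y, x) \<notin> r"
    using \<open>trans r\<close> \<open>irrefl r\<close> by (meson irrefl_def transD)
qed

lemma with_none_simps [simp]: "None \<in> with_none A" "Some x \<in> with_none A \<longleftrightarrow> x \<in> A"
  by (auto simp: with_none_def)

lemma mem_copies [simp]: "(\<phi>, j) \<in> copies \<Phi> k \<longleftrightarrow> \<phi> \<in> \<Phi> \<and> j \<in> {1..k \<phi>}"
  by (simp add: copies_def)

lemma stable_starD:
  assumes "\<nu> \<in> stable_star_matchings \<Phi> W k Q Pbar" "\<phi> \<in> \<Phi>" "j \<in> {1..k \<phi>}"
  shows "\<not> copy_blocks_star k Q \<nu> \<phi> j"
    and "w \<in> W \<Longrightarrow> \<not> pair_blocks_star k Q Pbar \<nu> \<phi> j w"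
proof -
  have "(\<phi>, j) \<in> copies \<Phi> k"
    using assms by simp
  then show "\<not> copy_blocks_star k Q \<nu> \<phi> j"
    and "w \<in> W \<Longrightarrow> \<not> pair_blocks_star k Q Pbar \<nu> \<phi> j w"
    using assms(1) unfolding stable_star_matchings_def by blast+
qed

text \<open>Two distinct best workers would each be preferred to the other, against asymmetry. This
  keeps workers apart when copies are rebuilt from a many-to-one matching.\<close>

lemma max_pref_unique:
  assumes "strict_pref_on A r" "v \<in> max_pref S r" "w \<in> max_pref S r"
  shows "v = w"
proof (rule ccontr)
  assume "v \<noteq> w"
  then have "(Some v, Some w) \<in> r" "(Some w, Some v) \<in> r"
    using assms(2,3) by (auto simp: max_pref_def)
  then show False
    using strict_pref_onD(3)[OF assms(1)] by blast
qed

text \<open>The workers' side determines which worker, if any, each copy gets, and off the market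
  both copy sides are \<open>undefined\<close>. Injectivity of merging thus reduces to comparing
  workers' sides.\<close>

lemma one_matching_eqI:
  assumes "is_one_matching \<Phi> W k \<nu>" "is_one_matching \<Phi> W k \<nu>'" "fst \<nu> = fst \<nu>'"
  shows "\<nu> = \<nu>'"
proof -
  have "snd \<nu> f = snd \<nu>' f" for f
  proof (cases "f \<in> copies \<Phi> k")
    case True
    then have "snd \<nu> f \<in> with_none W" "snd \<nu>' f \<in> with_none W"
      and "\<forall>w\<in>W. snd \<nu> f = Some w \<longleftrightarrow> snd \<nu>' f = Some w"
      using assms unfolding is_one_matching_def by (auto dest: PiE_mem)
    then show ?thesis
      by (metis not_None_eq with_none_simps(2))
  next
    case False
    then show ?thesis
      using assms unfolding is_one_matching_def by (metis PiE_arb)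
  qed
  then show ?thesis
    using assms(3) by (simp add: prod_eq_iff ext)
qed

text \<open>Since no copy is hit by two workers, its occupant can be read off by a definite
  description; a copy hit by nobody stays vacant.\<close>

lemma one_matching_exists:
  assumes F: "F \<in> W \<rightarrow>\<^sub>E with_none (copies \<Phi> k)"
    and inj: "\<And>v w f. v \<in> W \<Longrightarrow> w \<in> W \<Longrightarrow> F v = Some f \<Longrightarrow> F w = Some f \<Longrightarrow> v = w"
  obtains \<nu> where "is_one_matching \<Phi> W k \<nu>" "fst \<nu> = F"
proof -
  define G where "G = (\<lambda>f\<in>copies \<Phi> k.
    if \<exists>w\<in>W. F w = Some f then Some (THE w. w \<in> W \<and> F w = Some f) else None)"
  have G: "G f = Some w" if "f \<in> copies \<Phi> k" "w \<in> W" "F w = Some f" for f w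
  proof -
    have "(THE w. w \<in> W \<and> F w = Some f) = w"
      using that inj by (intro the_equality) auto
    then show ?thesis
      using that by (auto simp: G_def)
  qed
  have G': "G f = None" if "f \<in> copies \<Phi> k" "\<not> (\<exists>w\<in>W. F w = Some f)" for f
    using that by (simp add: G_def)
  have "G \<in> copies \<Phi> k \<rightarrow>\<^sub>E with_none W"
  proof
    fix f assume "f \<in> copies \<Phi> k"
    then show "G f \<in> with_none W"
      using G[of f] G'[of f] by (cases "\<exists>w\<in>W. F w = Some f") force+
  qed (simp add: G_def)
  moreover have "G f = Some w \<longleftrightarrow> F w = Some f" if "f \<in> copies \<Phi> k" "w \<in> W" for f w
    using G[OF that(1)] G'[OF that(1)] that(2) by (metis option.distinct(1) option.inject)
  ultimately have "is_one_matching \<Phi> W k (F, G)"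
    using F by (simp add: is_one_matching_def)
  with that show ?thesis by force
qed

lemma matching_eqI:
  assumes "is_matching \<Phi> W \<mu>" "is_matching \<Phi> W \<mu>'" "fst \<mu> = fst \<mu>'"
  shows "\<mu> = \<mu>'"
proof -
  have "snd \<mu> \<phi> = snd \<mu>' \<phi>" for \<phi>
  proof (cases "\<phi> \<in> \<Phi>")
    case True
    then have "snd \<mu> \<phi> \<subseteq> W" "snd \<mu>' \<phi> \<subseteq> W"
      and "\<forall>w\<in>W. w \<in> snd \<mu> \<phi> \<longleftrightarrow> w \<in> snd \<mu>' \<phi>"
      using assms unfolding is_matching_def by (auto dest: PiE_mem)
    then show ?thesis by blast
  next
    case False
    then show ?thesis
      using assms unfolding is_matching_def by (metis PiE_arb)
  qed
  then show ?thesis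
    using assms(3) by (simp add: prod_eq_iff ext)
qed

section \<open>Merging copies, and the canonical copy of a worker\<close>

text \<open>The staff of a firm is read off from the workers' side, so the two components agree by
  construction. The restricted abstractions make them extensional, as \<open>is_matching\<close>
  demands.\<close>

definition merge_copies :: "'f set \<Rightarrow> 'w set \<Rightarrow> ('f, 'w) one_matching \<Rightarrow> ('f, 'w) matching" where
  "merge_copies \<Phi> W \<nu> =
     (\<lambda>w\<in>W. map_option fst (fst \<nu> w), \<lambda>\<phi>\<in>\<Phi>. {w\<in>W. \<exists>j. fst \<nu> w = Some (\<phi>, j)})"

lemma merge_copies_is_matching:
  assumes "is_one_matching \<Phi> W k \<nu>"
  shows "is_matching \<Phi> W (merge_copies \<Phi> W \<nu>)"
proof -
  have "map_option fst (fst \<nu> w) \<in> with_none \<Phi>" if "w \<in> W" for w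
  proof -
    have "fst \<nu> w \<in> with_none (copies \<Phi> k)"
      using assms that unfolding is_one_matching_def by (auto dest: PiE_mem)
    then show ?thesis
      by (cases "fst \<nu> w") auto
  qed
  then show ?thesis
    by (auto simp: is_matching_def merge_copies_def)
qed

text \<open>Minimality reflects the workers' tastes: among copies of one firm the smaller index is
  preferred. The matching enters only through the staff \<open>S\<close>, so the notion makes sense
  in both markets.\<close>

definition first_copy :: "('f \<Rightarrow> nat) \<Rightarrow> ('f \<Rightarrow> nat \<Rightarrow> 'w option rel) \<Rightarrow> 'f \<Rightarrow> 'w set \<Rightarrow> 'w \<Rightarrow> nat \<Rightarrow> bool"
  where "first_copy k Q \<phi> S w j \<longleftrightarrow> j \<in> {1..k \<phi>} \<and> w \<in> max_pref S (Q \<phi> j) \<and>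
    (\<forall>i\<in>{1..k \<phi>}. w \<in> max_pref S (Q \<phi> i) \<longrightarrow> j \<le> i)"

lemma first_copy_unique:
  assumes "first_copy k Q \<phi> S w i" "first_copy k Q \<phi> S w j"
  shows "i = j"
  using assms by (auto simp: first_copy_def intro: antisym)

lemma first_copy_exists:
  assumes "\<exists>j\<in>{1..k \<phi>}. w \<in> max_pref S (Q \<phi> j)"
  shows "\<exists>j. first_copy k Q \<phi> S w j"
proof -
  let ?p = "\<lambda>j. j \<in> {1..k \<phi>} \<and> w \<in> max_pref S (Q \<phi> j)"
  have "?p (LEAST j. ?p j)"
    by (rule LeastI_ex) (use assms in blast)
  moreover have "(LEAST j. ?p j) \<le> i" if "?p i" for i
    using that by (rule Least_le)
  ultimately have "first_copy k Q \<phi> S w (LEAST j. ?p j)"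
    unfolding first_copy_def by blast
  then show ?thesis ..
qed

section \<open>Transfer of preferences between the two markets\<close>

locale decomposed_market =
  fixes \<Phi> :: "'f set" and W :: "'w set"
    and C :: "'f \<Rightarrow> 'w set \<Rightarrow> 'w set" and P :: "'w \<Rightarrow> 'f option rel"
    and k :: "'f \<Rightarrow> nat" and Q :: "'f \<Rightarrow> nat \<Rightarrow> 'w option rel"
    and Pbar :: "'w \<Rightarrow> 'f firm_copy option rel"
  assumes market: "many_to_one_market \<Phi> W C P"
    and decomposition: "\<And>\<phi>. \<phi> \<in> \<Phi> \<Longrightarrow> AM_decomposition W (C \<phi>) (k \<phi>) (Q \<phi>)"
    and associated: "\<And>w. w \<in> W \<Longrightarrow> associated_pref \<Phi> k (P w) (Pbar w)"
begin

lemma strict_P: "w \<in> W \<Longrightarrow> strict_pref_on \<Phi> (P w)"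
  using market by (simp add: many_to_one_market_def)

lemma strict_Pbar: "w \<in> W \<Longrightarrow> strict_pref_on (copies \<Phi> k) (Pbar w)"
  using associated by (simp add: associated_pref_def)

lemma strict_Q: "\<phi> \<in> \<Phi> \<Longrightarrow> j \<in> {1..k \<phi>} \<Longrightarrow> strict_pref_on W (Q \<phi> j)"
  using decomposition by (simp add: AM_decomposition_def)

lemma choice: "\<phi> \<in> \<Phi> \<Longrightarrow> S \<subseteq> W \<Longrightarrow> C \<phi> S = (\<Union>j\<in>{1..k \<phi>}. max_pref S (Q \<phi> j))"
  using decomposition by (simp add: AM_decomposition_def)

lemma Pbar_same_firm:
  "w \<in> W \<Longrightarrow> \<phi> \<in> \<Phi> \<Longrightarrow> i \<in> {1..k \<phi>} \<Longrightarrow> j \<in> {1..k \<phi>} \<Longrightarrow>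
    (Some (\<phi>, i), Some (\<phi>, j)) \<in> Pbar w \<longleftrightarrow> i < j"
  using associated unfolding associated_pref_def by blast

text \<open>For a copy this is part of \<open>associated_pref\<close>; for \<open>None\<close> both
  sides fail by irreflexivity. It makes individual rationality of workers the same in both
  markets.\<close>

lemma Pbar_unmatched:
  assumes "w \<in> W" "x \<in> with_none (copies \<Phi> k)"
  shows "(None, x) \<in> Pbar w \<longleftrightarrow> (None, map_option fst x) \<in> P w"
proof (cases x)
  case None
  then show ?thesis
    using strict_pref_onD(1)[OF strict_P[OF assms(1)]]
      strict_pref_onD(1)[OF strict_Pbar[OF assms(1)]] by simp
next
  case (Some f)
  then show ?thesis
    using assms associated[OF assms(1)] unfolding associated_pref_def by (cases f) auto
qed

text \<open>Between different firms \<open>associated_pref\<close> only lifts comparisons from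
  \<open>P w\<close> to \<open>Pbar w\<close>. The converse follows from totality of
  \<open>P w\<close>: otherwise the opposite comparison would be lifted, against asymmetry of
  \<open>Pbar w\<close>.\<close>

lemma Pbar_copy:
  assumes w: "w \<in> W" and x: "x \<in> with_none (copies \<Phi> k)"
    and \<phi>: "\<phi> \<in> \<Phi>" "j \<in> {1..k \<phi>}" and ne: "map_option fst x \<noteq> Some \<phi>"
  shows "(Some (\<phi>, j), x) \<in> Pbar w \<longleftrightarrow> (Some \<phi>, map_option fst x) \<in> P w"
proof (cases x)
  case None
  then show ?thesis
    using \<phi> associated[OF w] unfolding associated_pref_def by auto
next
  case (Some f)
  obtain \<psi> i where f: "f = (\<psi>, i)" by (cases f)
  then have \<psi>: "\<psi> \<in> \<Phi>" "i \<in> {1..k \<psi>}" "\<psi> \<noteq> \<phi>"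
    using Some x ne by auto
  have lift: "(Some \<alpha>, Some \<beta>) \<in> P w \<Longrightarrow> (Some (\<alpha>, a), Some (\<beta>, b)) \<in> Pbar w"
    if "\<alpha> \<in> \<Phi>" "\<beta> \<in> \<Phi>" "a \<in> {1..k \<alpha>}" "b \<in> {1..k \<beta>}" for \<alpha> \<beta> a b
    using that associated[OF w] unfolding associated_pref_def by blast
  have "(Some \<phi>, Some \<psi>) \<in> P w \<or> (Some \<psi>, Some \<phi>) \<in> P w"
    using strict_pref_onD(4)[OF strict_P[OF w]] \<phi> \<psi> by auto
  then show ?thesis
    using lift \<phi> \<psi> Some f strict_pref_onD(3)[OF strict_P[OF w]]
      strict_pref_onD(3)[OF strict_Pbar[OF w]] by (auto; blast)
qed

section \<open>Stability* of a one-to-one matching against stability of its merger\<close>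

context
  fixes \<nu> :: "('f, 'w) one_matching"
  assumes \<nu>: "is_one_matching \<Phi> W k \<nu>"
begin

abbreviation staff :: "'f \<Rightarrow> 'w set" where
  "staff \<phi> \<equiv> {w\<in>W. \<exists>j. fst \<nu> w = Some (\<phi>, j)}"

lemma worker_assignment: "w \<in> W \<Longrightarrow> fst \<nu> w \<in> with_none (copies \<Phi> k)"
  using \<nu> unfolding is_one_matching_def by (auto dest: PiE_mem)

lemma copy_assignment: "\<phi> \<in> \<Phi> \<Longrightarrow> j \<in> {1..k \<phi>} \<Longrightarrow> snd \<nu> (\<phi>, j) \<in> with_none W"
  using \<nu> unfolding is_one_matching_def by (auto dest: PiE_mem)

lemma copyD:
  assumes "w \<in> W" "fst \<nu> w = Some (\<phi>, j)"
  shows "\<phi> \<in> \<Phi>" "j \<in> {1..k \<phi>}"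
  using worker_assignment[OF assms(1)] assms(2) by auto

lemma assignment_iff:
  "\<phi> \<in> \<Phi> \<Longrightarrow> j \<in> {1..k \<phi>} \<Longrightarrow> w \<in> W \<Longrightarrow> snd \<nu> (\<phi>, j) = Some w \<longleftrightarrow> fst \<nu> w = Some (\<phi>, j)"
  using \<nu> unfolding is_one_matching_def by auto

text \<open>Turns conditions on the assignments of all copies, as in the star notions, into
  conditions on \<open>None\<close> and the staff.\<close>

lemma staff_cases:
  assumes "\<phi> \<in> \<Phi>" "j \<in> {1..k \<phi>}"
  obtains "snd \<nu> (\<phi>, j) = None" | v where "snd \<nu> (\<phi>, j) = Some v" "v \<in> staff \<phi>"
  using copy_assignment[OF assms] assignment_iff[OF assms]
  by (cases "snd \<nu> (\<phi>, j)") auto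

text \<open>Copy \<open>j\<close> does not block*, so \<open>w\<close> is acceptable to it and no
  colleague is better for it. If \<open>w\<close> were also best for a copy with smaller index,
  \<open>w\<close> and that copy would form a blocking* pair.\<close>

lemma stable_star_first_copy:
  assumes star: "\<nu> \<in> stable_star_matchings \<Phi> W k Q Pbar"
    and w: "w \<in> W" and wj: "fst \<nu> w = Some (\<phi>, j)"
  shows "first_copy k Q \<phi> (staff \<phi>) w j"
proof -
  note \<phi>j = copyD[OF w wj]
  note Qj = strict_Q[OF \<phi>j]
  have jw: "snd \<nu> (\<phi>, j) = Some w"
    using assignment_iff[OF \<phi>j w] wj by simp
  have nb: "\<not> copy_blocks_star k Q \<nu> \<phi> j"
    using stable_starD(1)[OF star \<phi>j] .
  have "(None, Some w) \<notin> Q \<phi> j"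
    using nb jw by (simp add: copy_blocks_star_def)
  then have acc: "(Some w, None) \<in> Q \<phi> j"
    using strict_pref_onD(4)[OF Qj, of "Some w" None] w by auto
  have "(Some w, Some v) \<in> Q \<phi> j" if v: "v \<in> staff \<phi>" "v \<noteq> w" for v
  proof -
    from v obtain i where i: "fst \<nu> v = Some (\<phi>, i)" and "v \<in> W" by auto
    then have "i \<in> {1..k \<phi>}" "snd \<nu> (\<phi>, i) = Some v"
      using copyD assignment_iff by blast+
    then have "(Some v, Some w) \<notin> Q \<phi> j"
      using nb jw unfolding copy_blocks_star_def by (metis option.distinct(1))
    then show ?thesis
      using strict_pref_onD(4)[OF Qj, of "Some w" "Some v"] v w by auto
  qed
  then have max: "w \<in> max_pref (staff \<phi>) (Q \<phi> j)"
    using acc w wj by (auto simp: max_pref_def)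
  have "j \<le> i" if i: "i \<in> {1..k \<phi>}" and wi: "w \<in> max_pref (staff \<phi>) (Q \<phi> i)" for i
  proof (rule ccontr)
    assume "\<not> j \<le> i"
    then have "(Some (\<phi>, i), fst \<nu> w) \<in> Pbar w"
      using Pbar_same_firm[OF w \<phi>j(1) i \<phi>j(2)] wj by simp
    \<comment> \<open>Being best in the staff does not put \<open>w\<close> above itself, so the
      exemption for the copy employing \<open>w\<close> is essential here.\<close>
    moreover have "(Some w, snd \<nu> (\<phi>, l)) \<in> Q \<phi> i"
      if "l \<in> {1..k \<phi>}" "snd \<nu> (\<phi>, l) \<noteq> Some w" for l
      using staff_cases[OF \<phi>j(1) that(1)] wi that(2) unfolding max_pref_def by cases auto
    ultimately have "pair_blocks_star k Q Pbar \<nu> \<phi> i w"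
      by (simp add: pair_blocks_star_def)
    then show False
      using stable_starD(2)[OF star \<phi>j(1) i w] by blast
  qed
  then show ?thesis
    using max \<phi>j by (simp add: first_copy_def)
qed

text \<open>A firm keeps its staff because each employee is best for the copy it occupies. A worker
  chosen from outside is best in the enlarged staff for some copy, which turns a blocking pair into
  a blocking* pair.\<close>

lemma merge_copies_stable:
  assumes star: "\<nu> \<in> stable_star_matchings \<Phi> W k Q Pbar"
  shows "merge_copies \<Phi> W \<nu> \<in> stable_matchings \<Phi> W C P"
proof -
  let ?\<mu> = "merge_copies \<Phi> W \<nu>"
  have "\<not> worker_blocks P ?\<mu> w" if "w \<in> W" for w
    using star that Pbar_unmatched[OF that worker_assignment[OF that]]
    by (auto simp: stable_star_matchings_def worker_blocks_def worker_blocks_star_def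
        merge_copies_def)
  moreover have "\<not> firm_blocks C ?\<mu> \<phi>" if \<phi>: "\<phi> \<in> \<Phi>" for \<phi>
  proof -
    have "C \<phi> (staff \<phi>) = (\<Union>j\<in>{1..k \<phi>}. max_pref (staff \<phi>) (Q \<phi> j))"
      by (rule choice[OF \<phi>]) auto
    \<comment> \<open>The union of best workers always lies inside the staff; this is the inclusion
      that uses stability*.\<close>
    moreover have "w \<in> (\<Union>j\<in>{1..k \<phi>}. max_pref (staff \<phi>) (Q \<phi> j))" if "w \<in> staff \<phi>" for w
      using that stable_star_first_copy[OF star] unfolding first_copy_def by blast
    ultimately have "C \<phi> (staff \<phi>) = staff \<phi>"
      by (auto simp: max_pref_def)
    then show ?thesis
      using \<phi> by (simp add: firm_blocks_def merge_copies_def)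
  qed
  moreover have "\<not> pair_blocks C P ?\<mu> w \<phi>" if w: "w \<in> W" and \<phi>: "\<phi> \<in> \<Phi>" for w \<phi>
  proof
    assume "pair_blocks C P ?\<mu> w \<phi>"
    then have out: "w \<notin> staff \<phi>" and chosen: "w \<in> C \<phi> (staff \<phi> \<union> {w})"
      and better: "(Some \<phi>, map_option fst (fst \<nu> w)) \<in> P w"
      using w \<phi> by (simp_all add: pair_blocks_def merge_copies_def)
    have "C \<phi> (staff \<phi> \<union> {w}) = (\<Union>j\<in>{1..k \<phi>}. max_pref (staff \<phi> \<union> {w}) (Q \<phi> j))"
      using w by (intro choice[OF \<phi>]) auto
    with chosen obtain j where j: "j \<in> {1..k \<phi>}" and max: "w \<in> max_pref (staff \<phi> \<union> {w}) (Q \<phi> j)"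
      by auto
    have "map_option fst (fst \<nu> w) \<noteq> Some \<phi>"
      using out w by auto
    then have "(Some (\<phi>, j), fst \<nu> w) \<in> Pbar w"
      using Pbar_copy[OF w worker_assignment[OF w] \<phi> j] better by blast
    moreover have "(Some w, snd \<nu> (\<phi>, l)) \<in> Q \<phi> j"
      if "l \<in> {1..k \<phi>}" "snd \<nu> (\<phi>, l) \<noteq> Some w" for l
      using staff_cases[OF \<phi> that(1)] max that(2) unfolding max_pref_def by cases auto
    ultimately have "pair_blocks_star k Q Pbar \<nu> \<phi> j w"
      by (simp add: pair_blocks_star_def)
    then show False
      using stable_starD(2)[OF star \<phi> j w] by blast
  qed
  ultimately show ?thesis
    using merge_copies_is_matching[OF \<nu>] by (simp add: stable_matchings_def)
qed

text \<open>A blocking* pair is excluded in two ways: for a worker from outside the firm by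
  stability of the merged matching, for an employee of the firm by minimality of the first
  copy.\<close>

lemma stable_starI:
  assumes stable: "merge_copies \<Phi> W \<nu> \<in> stable_matchings \<Phi> W C P"
    and first: "\<And>w \<phi> j. w \<in> W \<Longrightarrow> fst \<nu> w = Some (\<phi>, j) \<Longrightarrow> first_copy k Q \<phi> (staff \<phi>) w j"
  shows "\<nu> \<in> stable_star_matchings \<Phi> W k Q Pbar"
proof -
  have max: "v \<in> max_pref (staff \<phi>) (Q \<phi> j)"
    if "\<phi> \<in> \<Phi>" "j \<in> {1..k \<phi>}" "snd \<nu> (\<phi>, j) = Some v" for v \<phi> j
  proof -
    have v: "v \<in> W"
      using copy_assignment[OF that(1,2)] that(3) by simp
    then show ?thesis
      using first[OF v] assignment_iff[OF that(1,2) v] that(3) by (simp add: first_copy_def)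
  qed
  have "\<not> worker_blocks_star Pbar \<nu> w" if "w \<in> W" for w
    using stable that Pbar_unmatched[OF that worker_assignment[OF that]]
    by (auto simp: stable_matchings_def worker_blocks_def worker_blocks_star_def
        merge_copies_def)
  moreover have "\<not> copy_blocks_star k Q \<nu> \<phi> j" if \<phi>: "\<phi> \<in> \<Phi>" "j \<in> {1..k \<phi>}" for \<phi> j
  proof -
    note Qj = strict_pref_onD[OF strict_Q[OF \<phi>]]
    show ?thesis
    proof (cases "snd \<nu> (\<phi>, j)")
      case None
      then show ?thesis
        using Qj(1) by (simp add: copy_blocks_star_def)
    next
      case (Some v)
      have best: "(Some v, None) \<in> Q \<phi> j"
        "\<And>u. u \<in> staff \<phi> \<Longrightarrow> u \<noteq> v \<Longrightarrow> (Some v, Some u) \<in> Q \<phi> j"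
        using max[OF \<phi> Some] by (auto simp: max_pref_def)
      have "(snd \<nu> (\<phi>, l), Some v) \<notin> Q \<phi> j" if l: "l \<in> {1..k \<phi>}" for l
        using \<phi>(1) l
      proof (cases rule: staff_cases)
        case 1
        then show ?thesis using best(1) Qj(3) by simp
      next
        case (2 u)
        \<comment> \<open>The case \<open>u = v\<close> occurs for \<open>l = j\<close> and is
          settled by irreflexivity.\<close>
        then show ?thesis using best(2)[of u] Qj(1,3) by metis
      qed
      then show ?thesis
        using Some best(1) Qj(3) by (auto simp: copy_blocks_star_def)
    qed
  qed
  moreover have "\<not> pair_blocks_star k Q Pbar \<nu> \<phi> j w"
    if \<phi>: "\<phi> \<in> \<Phi>" "j \<in> {1..k \<phi>}" and w: "w \<in> W" for \<phi> j w
  proof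
    note Qj = strict_pref_onD[OF strict_Q[OF \<phi>]]
    assume "pair_blocks_star k Q Pbar \<nu> \<phi> j w"
    then have better: "(Some (\<phi>, j), fst \<nu> w) \<in> Pbar w"
      and above: "\<And>l. l \<in> {1..k \<phi>} \<Longrightarrow> snd \<nu> (\<phi>, l) \<noteq> Some w \<Longrightarrow> (Some w, snd \<nu> (\<phi>, l)) \<in> Q \<phi> j"
      by (auto simp: pair_blocks_star_def)
    \<comment> \<open>A strict improvement cannot be the copy already held, so the exemption in
      \<open>pair_blocks_star\<close> does not apply to copy \<open>j\<close>.\<close>
    have "fst \<nu> w \<noteq> Some (\<phi>, j)"
      using better strict_pref_onD(1)[OF strict_Pbar[OF w]] by metis
    then have "(Some w, snd \<nu> (\<phi>, j)) \<in> Q \<phi> j"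
      using above[OF \<phi>(2)] assignment_iff[OF \<phi> w] by simp
    \<comment> \<open>Copy \<open>j\<close> is either vacant or employs an acceptable worker, so \<open>w\<close> is acceptable too.\<close>
    moreover have "snd \<nu> (\<phi>, j) = None \<or> (snd \<nu> (\<phi>, j), None) \<in> Q \<phi> j"
      using max[OF \<phi>] by (cases "snd \<nu> (\<phi>, j)") (auto simp: max_pref_def)
    ultimately have acc: "(Some w, None) \<in> Q \<phi> j"
      using Qj(2) by metis
    have "(Some w, Some v) \<in> Q \<phi> j" if v: "v \<in> staff \<phi>" "v \<noteq> w" for v
    proof -
      from v obtain l where "fst \<nu> v = Some (\<phi>, l)" "v \<in> W" by auto
      then have "l \<in> {1..k \<phi>}" "snd \<nu> (\<phi>, l) = Some v"
        using copyD assignment_iff by blast+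
      then show ?thesis
        using above[of l] v by simp
    qed
    then have wmax: "w \<in> max_pref (staff \<phi> \<union> {w}) (Q \<phi> j)"
      using acc by (auto simp: max_pref_def)
    show False
    proof (cases "w \<in> staff \<phi>")
      case True
      then obtain i where i: "fst \<nu> w = Some (\<phi>, i)" by auto
      \<comment> \<open>Within one firm a preferred copy has a smaller index, which contradicts that
        \<open>i\<close> is the first copy for which \<open>w\<close> is best.\<close>
      have "j < i"
        using better i Pbar_same_firm[OF w \<phi>(1) \<phi>(2) copyD(2)[OF w i]] by simp
      moreover have "w \<in> max_pref (staff \<phi>) (Q \<phi> j)"
        using wmax True by (simp add: insert_absorb)
      ultimately show False
        using first[OF w i] \<phi>(2) by (force simp: first_copy_def)
    next
      case False
      then have ne: "map_option fst (fst \<nu> w) \<noteq> Some \<phi>"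
        using w by auto
      have "C \<phi> (staff \<phi> \<union> {w}) = (\<Union>j\<in>{1..k \<phi>}. max_pref (staff \<phi> \<union> {w}) (Q \<phi> j))"
        using w by (intro choice[OF \<phi>(1)]) auto
      then have "w \<in> C \<phi> (staff \<phi> \<union> {w})"
        using wmax \<phi>(2) by blast
      moreover have "(Some \<phi>, map_option fst (fst \<nu> w)) \<in> P w"
        using better Pbar_copy[OF w worker_assignment[OF w] \<phi> ne] by blast
      ultimately have "pair_blocks C P (merge_copies \<Phi> W \<nu>) w \<phi>"
        using False w \<phi> by (simp add: pair_blocks_def merge_copies_def)
      then show False
        using stable w \<phi> by (simp add: stable_matchings_def)
    qed
  qed
  ultimately show ?thesis
    using \<nu> by (auto simp: stable_star_matchings_def)
qed

end

section \<open>Bijectivity of merging\<close>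

text \<open>Equal mergers give each worker the same firm and each firm the same staff. By stability*
  the copy held is then the first copy for that staff in both matchings, hence the same.\<close>

lemma merge_copies_inj: "inj_on (merge_copies \<Phi> W) (stable_star_matchings \<Phi> W k Q Pbar)"
proof (rule inj_onI)
  fix \<nu> \<nu>'
  assume star: "\<nu> \<in> stable_star_matchings \<Phi> W k Q Pbar" "\<nu>' \<in> stable_star_matchings \<Phi> W k Q Pbar"
    and eq: "merge_copies \<Phi> W \<nu> = merge_copies \<Phi> W \<nu>'"
  then have one: "is_one_matching \<Phi> W k \<nu>" "is_one_matching \<Phi> W k \<nu>'"
    by (auto simp: stable_star_matchings_def)
  have "fst \<nu> w = fst \<nu>' w" for w
  proof (cases "w \<in> W")
    case True
    then have firm: "map_option fst (fst \<nu> w) = map_option fst (fst \<nu>' w)"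
      using fun_cong[OF arg_cong[OF eq, of fst], of w] by (simp add: merge_copies_def)
    show ?thesis
    proof (cases "fst \<nu> w")
      case None
      then show ?thesis using firm by simp
    next
      case (Some f)
      obtain \<phi> i where i: "fst \<nu> w = Some (\<phi>, i)"
        using Some by (cases f) auto
      then obtain j where j: "fst \<nu>' w = Some (\<phi>, j)"
        using firm by (cases "fst \<nu>' w") auto
      have "\<phi> \<in> \<Phi>"
        using copyD(1)[OF one(1) True i] .
      then have staff: "{w\<in>W. \<exists>j. fst \<nu> w = Some (\<phi>, j)} = {w\<in>W. \<exists>j. fst \<nu>' w = Some (\<phi>, j)}"
        using fun_cong[OF arg_cong[OF eq, of snd], of \<phi>] by (simp add: merge_copies_def)
      have "i = j"
        using stable_star_first_copy[OF one(1) star(1) True i, unfolded staff]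
          stable_star_first_copy[OF one(2) star(2) True j] by (rule first_copy_unique)
      then show ?thesis using i j by simp
    qed
  next
    case False
    then show ?thesis
      using one unfolding is_one_matching_def by (metis PiE_arb)
  qed
  then show "\<nu> = \<nu>'"
    using one_matching_eqI[OF one] by blast
qed

text \<open>The preimage seats every employed worker at the first copy for which it is best in its
  firm's staff. Merging recovers the given matching, and \<open>stable_starI\<close> gives
  stability*.\<close>

lemma merge_copies_surj:
  assumes stable: "\<mu> \<in> stable_matchings \<Phi> W C P"
  shows "\<mu> \<in> merge_copies \<Phi> W ` stable_star_matchings \<Phi> W k Q Pbar"
proof -
  have \<mu>: "is_matching \<Phi> W \<mu>"
    using stable by (simp add: stable_matchings_def)
  have firm: "\<phi> \<in> \<Phi>" "w \<in> snd \<mu> \<phi>" if "w \<in> W" "fst \<mu> w = Some \<phi>" for w \<phi>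
  proof -
    have "fst \<mu> w \<in> with_none \<Phi>"
      using \<mu> that(1) unfolding is_matching_def by (auto dest: PiE_mem)
    then show "\<phi> \<in> \<Phi>"
      using that(2) by simp
    then show "w \<in> snd \<mu> \<phi>"
      using \<mu> that by (simp add: is_matching_def)
  qed
  have "\<exists>j. first_copy k Q \<phi> (snd \<mu> \<phi>) w j" if w: "w \<in> W" "fst \<mu> w = Some \<phi>" for w \<phi>
  proof -
    note \<phi> = firm[OF w]
    have "snd \<mu> \<phi> \<subseteq> W"
      using \<mu> \<phi>(1) unfolding is_matching_def by (auto dest: PiE_mem)
    \<comment> \<open>Since the firm does not block, its staff is a union of best workers, so each
      employee is best for at least one copy.\<close>
    moreover have "snd \<mu> \<phi> = C \<phi> (snd \<mu> \<phi>)"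
      using stable \<phi>(1) by (simp add: stable_matchings_def firm_blocks_def)
    ultimately have "w \<in> (\<Union>j\<in>{1..k \<phi>}. max_pref (snd \<mu> \<phi>) (Q \<phi> j))"
      using choice[OF \<phi>(1)] \<phi>(2) by metis
    then show ?thesis
      by (intro first_copy_exists) auto
  qed
  then obtain c where
    c: "\<And>w \<phi>. w \<in> W \<Longrightarrow> fst \<mu> w = Some \<phi> \<Longrightarrow> first_copy k Q \<phi> (snd \<mu> \<phi>) w (c w \<phi>)"
    by metis
  define F where "F = (\<lambda>w\<in>W. map_option (\<lambda>\<phi>. (\<phi>, c w \<phi>)) (fst \<mu> w))"
  have F_iff: "F w = Some (\<phi>, j) \<longleftrightarrow> fst \<mu> w = Some \<phi> \<and> j = c w \<phi>" if "w \<in> W" for w \<phi> j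
    using that by (auto simp: F_def)
  have F_dom: "F \<in> W \<rightarrow>\<^sub>E with_none (copies \<Phi> k)"
  proof
    fix w assume w: "w \<in> W"
    show "F w \<in> with_none (copies \<Phi> k)"
      using w firm[OF w] c[OF w] by (cases "fst \<mu> w") (auto simp: F_def first_copy_def)
  qed (simp add: F_def)
  \<comment> \<open>Workers seated at the same copy belong to the same firm and are both best in its
    staff for that copy's order.\<close>
  have F_inj: "v = w" if vw: "v \<in> W" "w \<in> W" and f: "F v = Some f" "F w = Some f" for v w f
  proof -
    obtain \<phi> j where [simp]: "f = (\<phi>, j)" by (cases f)
    have v: "fst \<mu> v = Some \<phi>" "j = c v \<phi>" and w: "fst \<mu> w = Some \<phi>" "j = c w \<phi>"
      using F_iff vw f by auto
    have "j \<in> {1..k \<phi>}" "v \<in> max_pref (snd \<mu> \<phi>) (Q \<phi> j)" "w \<in> max_pref (snd \<mu> \<phi>) (Q \<phi> j)"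
      using c[OF vw(1) v(1)] c[OF vw(2) w(1)] v(2) w(2) by (simp_all add: first_copy_def)
    then show ?thesis
      using max_pref_unique[OF strict_Q[OF firm(1)[OF vw(1) v(1)]]] by blast
  qed
  obtain \<nu> where \<nu>: "is_one_matching \<Phi> W k \<nu>" "fst \<nu> = F"
    by (rule one_matching_exists[OF F_dom F_inj])
  have "fst (merge_copies \<Phi> W \<nu>) w = fst \<mu> w" for w
  proof (cases "w \<in> W")
    case True
    then show ?thesis
      by (simp add: merge_copies_def \<nu>(2) F_def option.map_comp comp_def option.map_ident)
  next
    case False
    then show ?thesis
      using \<mu> unfolding is_matching_def merge_copies_def by (metis PiE_arb fst_conv restrict_apply)
  qed
  then have eq: "merge_copies \<Phi> W \<nu> = \<mu>"
    using matching_eqI[OF merge_copies_is_matching[OF \<nu>(1)] \<mu>] by blast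
  have "first_copy k Q \<phi> {w\<in>W. \<exists>j. fst \<nu> w = Some (\<phi>, j)} w j"
    if w: "w \<in> W" and "fst \<nu> w = Some (\<phi>, j)" for w \<phi> j
  proof -
    have wj: "fst \<mu> w = Some \<phi>" "j = c w \<phi>"
      using F_iff[OF w] that \<nu>(2) by auto
    \<comment> \<open>The first copies were taken relative to the staff under \<open>\<mu>\<close>;
      as \<open>\<nu>\<close> merges to \<open>\<mu>\<close>, this is also the staff under
      \<open>\<nu>\<close>.\<close>
    have "{w\<in>W. \<exists>j. fst \<nu> w = Some (\<phi>, j)} = snd \<mu> \<phi>"
      using firm(1)[OF w wj(1)] unfolding eq[symmetric] merge_copies_def by simp
    then show ?thesis
      using c[OF w wj(1)] wj(2) by simp
  qed
  then have "\<nu> \<in> stable_star_matchings \<Phi> W k Q Pbar"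
    using stable_starI[OF \<nu>(1)] stable eq by blast
  then show ?thesis
    using eq by blast
qed

lemma merge_copies_bij:
  "bij_betw (merge_copies \<Phi> W) (stable_star_matchings \<Phi> W k Q Pbar) (stable_matchings \<Phi> W C P)"
proof -
  have "merge_copies \<Phi> W \<nu> \<in> stable_matchings \<Phi> W C P"
    if "\<nu> \<in> stable_star_matchings \<Phi> W k Q Pbar" for \<nu>
    using that by (intro merge_copies_stable) (auto simp: stable_star_matchings_def)
  then show ?thesis
    using merge_copies_inj merge_copies_surj by (auto simp: bij_betw_def)
qed

end

theorem theorem3:
  fixes \<Phi> :: "'f set" and W :: "'w set"
    and C :: "'f \<Rightarrow> 'w set \<Rightarrow> 'w set" and P :: "'w \<Rightarrow> 'f option rel"
    and k :: "'f \<Rightarrow> nat" and Q :: "'f \<Rightarrow> nat \<Rightarrow> 'w option rel"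
    and Pbar :: "'w \<Rightarrow> 'f firm_copy option rel"
  assumes "many_to_one_market \<Phi> W C P"
    and "\<forall>\<phi>\<in>\<Phi>. path_independent W (C \<phi>)"
    and "\<forall>\<phi>\<in>\<Phi>. AM_decomposition W (C \<phi>) (k \<phi>) (Q \<phi>)"
    and "\<forall>w\<in>W. associated_pref \<Phi> k (P w) (Pbar w)"
  shows "\<exists>T. bij_betw T (stable_star_matchings \<Phi> W k Q Pbar) (stable_matchings \<Phi> W C P)"
proof -
  interpret decomposed_market \<Phi> W C P k Q Pbar
    by unfold_locales (use assms in blast)+
  show ?thesis
    using merge_copies_bij by blast
qed

end
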